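(* Let $C:f=0$ be a reduced curve in $\mathbb{P}^2$ and let $L$ be a line in $\mathbb{P}^2$ which is not an irreducible component of $C$. Consider the union $C'=C\cup L:f'=0$ and assume that $C$ is a free curve. Then $C'$ is either a free curve or a plus-one generated curve.
   Context: Let $S=\mathbb{C}[x,y,z]$. For a reduced homogeneous polynomial $f\in S$ of degree $d$ defining a plane curve $C:f=0$ (the paper works with reduced curves of degree $d\ge 3$), let $D_0(f)=\{(a,b,c)\in S^3 : af_x+bf_y+cf_z=0\}$ be the graded $S$-module of Jacobian syzygies. If $D_0(f)$ is minimally generated by $m$ homogeneous elements, of degrees $d_1\le d_2\le\dots\le d_m$ (these are independent of the choice of minimal generators), the degrees $(d_1,\dots,d_m)$ are called the exponents of $C$. The curve $C$ is free if $m=2$ (i.e. $D_0(f)$ is a free $S$-module of rank 2), and $C$ is plus-one generated if $m=3$ and $d_1+d_2=d$. *)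

theory Defs
  imports "HOL-Computational_Algebra.Computational_Algebra"
begin

text \<open>S = C[x,y,z] is modelled as complex poly poly poly: the outermost variable is z,
  the middle one y, the innermost one x.  The monomial x^l y^j z^i has coefficient
  coeff (coeff (coeff f i) j) l.\<close>

type_synonym poly3 = "complex poly poly poly"

definition hom :: "nat \<Rightarrow> poly3 \<Rightarrow> bool" where
  "hom k f \<longleftrightarrow> (\<forall>i j l. coeff (coeff (coeff f i) j) l \<noteq> 0 \<longrightarrow> i + j + l = k)"

definition dX :: "poly3 \<Rightarrow> poly3" where "dX f = map_poly (map_poly pderiv) f"
definition dY :: "poly3 \<Rightarrow> poly3" where "dY f = map_poly pderiv f"
definition dZ :: "poly3 \<Rightarrow> poly3" where "dZ f = pderiv f"

type_synonym trip = "poly3 \<times> poly3 \<times> poly3"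

definition D0 :: "poly3 \<Rightarrow> trip set" where
  "D0 f = {(a, b, c). a * dX f + b * dY f + c * dZ f = 0}"

definition span3 :: "trip list \<Rightarrow> trip set" where
  "span3 gs = {((\<Sum>i<length gs. rs i * fst (gs ! i)),
                (\<Sum>i<length gs. rs i * fst (snd (gs ! i))),
                (\<Sum>i<length gs. rs i * snd (snd (gs ! i)))) | rs. True}"

definition htrip :: "nat \<Rightarrow> trip \<Rightarrow> bool" where
  "htrip k v \<longleftrightarrow> hom k (fst v) \<and> hom k (fst (snd v)) \<and> hom k (snd (snd v))"

definition hom_gen_sys :: "poly3 \<Rightarrow> trip list \<Rightarrow> nat list \<Rightarrow> bool" where
  "hom_gen_sys f gs ds \<longleftrightarrow> length gs = length ds \<and>
     (\<forall>i<length gs. htrip (ds ! i) (gs ! i) \<and> gs ! i \<noteq> (0, 0, 0)) \<and>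
     span3 gs = D0 f"

definition mingens :: "poly3 \<Rightarrow> nat \<Rightarrow> bool" where
  "mingens f m \<longleftrightarrow> (\<exists>gs ds. hom_gen_sys f gs ds \<and> length gs = m) \<and>
     (\<forall>gs ds. hom_gen_sys f gs ds \<longrightarrow> m \<le> length gs)"

definition free_curve :: "poly3 \<Rightarrow> bool" where
  "free_curve f \<longleftrightarrow> mingens f 2"

text \<open>Plus-one generated, for a curve of degree d: m = 3 and the exponents
  d1 \<le> d2 \<le> d3 (degrees of a minimal homogeneous generating system) satisfy d1 + d2 = d.\<close>
definition plus_one_generated :: "poly3 \<Rightarrow> nat \<Rightarrow> bool" where
  "plus_one_generated f d \<longleftrightarrow> mingens f 3 \<and>
     (\<exists>gs ds. hom_gen_sys f gs ds \<and> length gs = 3 \<and> sorted ds \<and> ds ! 0 + ds ! 1 = d)"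

end

theory Submission
  imports Defs "HOL-Library.Product_Plus" "HOL-Computational_Algebra.Field_as_Ring"
begin

text \<open>Let \<open>E\<close> be the Euler derivation. For \<open>\<theta>\<close> in \<open>D0 f\<close> with \<open>\<theta> l = s l\<close>, the derivation
  \<open>\<theta> - s / (d + 1) E\<close> lies in \<open>D0 (f l)\<close>, and since \<open>l\<close> is prime and does not divide \<open>f\<close>, this
  identifies \<open>D0 (f l)\<close> with the \<open>\<theta>\<close> in \<open>D0 f\<close> such that \<open>l\<close> divides \<open>\<theta> l\<close>. If \<open>r1\<close>, \<open>r2\<close> is a
  basis of \<open>D0 f\<close> of degrees \<open>d1 \<le> d2\<close>, this is a condition on the coordinates of \<open>\<theta>\<close>: they form
  a syzygy modulo \<open>l\<close> of the forms \<open>r1 l\<close> and \<open>r2 l\<close>. On the line these are binary forms \<open>g b1\<close>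
  and \<open>g b2\<close> with \<open>b1\<close>, \<open>b2\<close> coprime, so that \<open>l r1\<close>, \<open>l r2\<close> and \<open>b2 r1 - b1 r2\<close> are generators,
  of degrees \<open>d1 + 1\<close>, \<open>d2 + 1\<close> and \<open>d1 + d2 - deg g\<close>. If \<open>b1\<close> or \<open>b2\<close> is a unit, one generator is
  redundant and the new curve is free; otherwise the third degree is the largest, and the first
  two add up to \<open>d + 1\<close> because \<open>d1 + d2 = d - 1\<close> by Saito's criterion.\<close>

section \<open>Homogeneous polynomials in three variables\<close>

definition is_ring_map :: "('a::comm_ring_1 \<Rightarrow> 'b::comm_ring_1) \<Rightarrow> bool" where
  "is_ring_map f \<longleftrightarrow> f 0 = 0 \<and> f 1 = 1 \<and> (\<forall>a b. f (a + b) = f a + f b) \<and> (\<forall>a b. f (a * b) = f a * f b)"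

lemma is_ring_map_simps:
  assumes "is_ring_map f"
  shows "f 0 = 0" "f 1 = 1" "f (a + b) = f a + f b" "f (a * b) = f a * f b"
    "f (- a) = - f a" "f (a - b) = f a - f b" "f (a ^ n) = f a ^ n"
    "f (sum g I) = (\<Sum>i\<in>I. f (g i))"
proof -
  show 1: "f 0 = 0" "f 1 = 1" and 2: "\<And>a b. f (a + b) = f a + f b" and 3: "\<And>a b. f (a * b) = f a * f b"
    using assms by (auto simp: is_ring_map_def)
  show 4: "f (- a) = - f a" for a
    using 2[of a "- a"] 1 by (simp add: eq_neg_iff_add_eq_0 add.commute)
  show "f (a - b) = f a - f b" using 2[of a "- b"] 4 by simp
  show "f (a ^ n) = f a ^ n" by (induction n) (simp_all add: 1 3)
  show "f (sum g I) = (\<Sum>i\<in>I. f (g i))"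
    by (induction I rule: infinite_finite_induct) (simp_all add: 1 2)
qed

text \<open>Universal property of a polynomial ring in one variable; three nested uses give
  \<open>eval3\<close>.\<close>

lemma ring_map_eval:
  assumes "is_ring_map c"
  shows "is_ring_map (\<lambda>p. poly (map_poly c p) t)"
proof -
  note c = is_ring_map_simps[OF assms]
  let ?e = "\<lambda>p. poly (map_poly c p) t"
  have p: "?e (pCons a p) = c a + t * ?e p" for a p by (simp add: map_poly_pCons c)
  have add: "?e (p + q) = ?e p + ?e q" for p q
  proof (induction p q rule: poly_induct2)
    case (pCons a p b q)
    then show ?case by (simp only: add_pCons p c) (simp add: algebra_simps)
  qed simp
  have smult: "?e (smult a q) = c a * ?e q" for a q
    by (induction q) (simp, simp only: smult_pCons p c, simp add: algebra_simps)
  have "?e (p * q) = ?e p * ?e q" for p q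
    by (induction p) (simp, simp only: mult_pCons_left add smult p c, simp add: algebra_simps)
  moreover have "?e 1 = 1" using p[of 1 0] c by (simp add: one_pCons)
  ultimately show ?thesis using add by (simp add: is_ring_map_def)
qed

text \<open>The homomorphism that extends \<open>c\<close> and sends x, y, z to \<open>A\<close>,
  \<open>B\<close>, \<open>C\<close>; the nesting mirrors the type, with x innermost.\<close>

definition eval3 :: "(complex \<Rightarrow> 'r) \<Rightarrow> 'r \<Rightarrow> 'r \<Rightarrow> 'r \<Rightarrow> poly3 \<Rightarrow> 'r::comm_ring_1" where
  "eval3 c A B C p =
     poly (map_poly (\<lambda>q. poly (map_poly (\<lambda>r. poly (map_poly c r) A) q) B) p) C"

lemma ring_map_eval3: "is_ring_map c \<Longrightarrow> is_ring_map (eval3 c A B C)"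
  unfolding eval3_def[abs_def] by (intro ring_map_eval)

abbreviation cst :: "complex \<Rightarrow> poly3" where "cst a \<equiv> [:[:[:a:]:]:]"
abbreviation VX :: poly3 where "VX \<equiv> [:[:[:0, 1:]:]:]"
abbreviation VY :: poly3 where "VY \<equiv> [:[:0, 1:]:]"
abbreviation VZ :: poly3 where "VZ \<equiv> [:0, 1:]"

lemma ring_map_cst: "is_ring_map cst" by (simp add: is_ring_map_def one_pCons)

lemma eval3_gens:
  assumes "is_ring_map c"
  shows "eval3 c A B C (cst a) = c a" "eval3 c A B C VX = A" "eval3 c A B C VY = B" "eval3 c A B C VZ = C"
  using is_ring_map_simps[OF assms] by (simp_all add: eval3_def map_poly_pCons)

abbreviation coeff3 :: "poly3 \<Rightarrow> nat \<Rightarrow> nat \<Rightarrow> nat \<Rightarrow> complex" where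
  "coeff3 p i j l \<equiv> coeff (coeff (coeff p i) j) l"

abbreviation mono3 :: "complex \<Rightarrow> nat \<Rightarrow> nat \<Rightarrow> nat \<Rightarrow> poly3" where
  "mono3 a i j l \<equiv> monom (monom (monom a l) j) i"

lemma mono3_eq: "mono3 a i j l = cst a * VX ^ l * VY ^ j * VZ ^ i"
proof -
  have "VY ^ j = [:monom 1 j:]" for j
    by (induction j) (simp_all add: one_pCons[symmetric] monom_Suc)
  moreover have "[:0, 1 :: complex poly:] = monom 1 1" by (simp add: monom_altdef)
  moreover have "VX ^ l = [:[:monom 1 l:]:]" for l
    by (induction l) (simp_all add: one_pCons[symmetric] monom_Suc)
  moreover have "VZ ^ i = monom 1 i" for i by (simp add: monom_altdef)
  ultimately show ?thesis by (simp add: smult_monom)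
qed

lemma poly3_expand:
  "p = (\<Sum>i\<le>degree p. \<Sum>j\<le>degree (coeff p i). \<Sum>l\<le>degree (coeff (coeff p i) j). mono3 (coeff3 p i j l) i j l)"
  by (simp add: monom_sum[symmetric] poly_as_sum_of_monoms)

lemma sum_closed:
  assumes "P 0" "\<And>p q. P p \<Longrightarrow> P q \<Longrightarrow> P (p + q)" "\<And>i. i \<in> I \<Longrightarrow> P (g i)"
  shows "P (sum g I)"
  using assms by (induction I rule: infinite_finite_induct) auto

lemma hom_induct [consumes 1, case_names zero add mono]:
  assumes "hom k p" and "P 0" and "\<And>p q. P p \<Longrightarrow> P q \<Longrightarrow> P (p + q)"
    and "\<And>a i j l. i + j + l = k \<Longrightarrow> P (mono3 a i j l)"
  shows "P p"
proof -
  \<comment> \<open>Monomials with coefficient zero may have the wrong degree, so they fall under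
    \<open>P 0\<close>.\<close>
  have "P (mono3 (coeff3 p i j l) i j l)" for i j l
  proof (cases "coeff3 p i j l = 0")
    case False then show ?thesis using assms(1,4) by (auto simp: hom_def)
  qed (use assms(2) in simp)
  then show ?thesis by (subst poly3_expand) (intro sum_closed[of P] assms(2,3))
qed

lemma poly3_induct [case_names zero add mono]:
  assumes "P 0" and "\<And>p q. P p \<Longrightarrow> P q \<Longrightarrow> P (p + q)" and "\<And>a i j l. P (mono3 a i j l)"
  shows "P p"
  by (subst poly3_expand) (intro sum_closed[of P] assms)

lemma ring_map_mono3:
  "is_ring_map f \<Longrightarrow> f (mono3 a i j l) = f (cst a) * f VX ^ l * f VY ^ j * f VZ ^ i"
  by (simp add: mono3_eq is_ring_map_simps del: mult_pCons_left mult_pCons_right)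

lemma poly3_eqI: "(\<And>i j l. coeff3 p i j l = coeff3 q i j l) \<Longrightarrow> p = q"
  by (simp add: poly_eq_iff)

text \<open>\<open>homog p\<close> is \<open>p(tx, ty, tz)\<close> as a polynomial in \<open>t\<close>: a form becomes a monomial in \<open>t\<close>, so that
  factors of forms are forms.\<close>

definition homog :: "poly3 \<Rightarrow> poly3 poly" where
  "homog = eval3 (\<lambda>a. [:cst a:]) (monom VX 1) (monom VY 1) (monom VZ 1)"

lemma ring_map_homog: "is_ring_map homog"
  unfolding homog_def by (intro ring_map_eval3) (simp add: is_ring_map_def one_pCons)

lemma homog_mono3: "homog (mono3 a i j l) = monom (mono3 a i j l) (i + j + l)"
proof -
  have c: "is_ring_map (\<lambda>a. [:cst a:])" by (simp add: is_ring_map_def one_pCons)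
  have "homog (mono3 a i j l) = [:cst a:] * monom VX 1 ^ l * monom VY 1 ^ j * monom VZ 1 ^ i"
    by (simp only: ring_map_mono3[OF ring_map_homog]) (simp only: homog_def eval3_gens[OF c])
  also have "\<dots> = monom (cst a * VX ^ l * VY ^ j * VZ ^ i) (l + j + i)"
    by (simp only: monom_power mult_monom monom_0[symmetric]) simp
  finally show ?thesis by (simp only: mono3_eq ac_simps)
qed

lemma poly_homog_1: "poly (homog p) 1 = p"
  by (induction p rule: poly3_induct) (simp_all add: is_ring_map_simps[OF ring_map_homog] homog_mono3 poly_monom)

lemma coeff3_homog: "coeff3 (coeff (homog p) n) i j l = (if i + j + l = n then coeff3 p i j l else 0)"
  by (induction p rule: poly3_induct) (auto simp: is_ring_map_simps[OF ring_map_homog] homog_mono3)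

text \<open>Coefficient \<open>k\<close> of \<open>homog p\<close> is the component of degree
  \<open>k\<close>. Homogeneity becomes an equation for a ring map, from which the closure rules
  follow.\<close>

lemma hom_iff_homog: "hom k p \<longleftrightarrow> homog p = monom p k"
proof
  assume "hom k p"
  then show "homog p = monom p k"
    by (induction rule: hom_induct) (auto simp: is_ring_map_simps[OF ring_map_homog] homog_mono3 add_monom)
next
  assume h: "homog p = monom p k"
  show "hom k p" unfolding hom_def using coeff3_homog[of p k] h by auto metis
qed

section \<open>Closure properties, degrees and factors of forms\<close>

lemma hom_0 [simp]: "hom k 0" by (simp add: hom_def)
lemma hom_add: "hom k p \<Longrightarrow> hom k q \<Longrightarrow> hom k (p + q)"
  by (simp add: hom_iff_homog is_ring_map_simps[OF ring_map_homog] add_monom)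
lemma hom_minus: "hom k p \<Longrightarrow> hom k (- p)"
  by (simp add: hom_iff_homog is_ring_map_simps[OF ring_map_homog] minus_monom)
lemma hom_diff: "hom k p \<Longrightarrow> hom k q \<Longrightarrow> hom k (p - q)"
  using hom_add[of k p "- q"] hom_minus[of k q] by simp
lemma hom_mult: "hom j p \<Longrightarrow> hom k q \<Longrightarrow> hom (j + k) (p * q)"
  by (simp add: hom_iff_homog is_ring_map_simps[OF ring_map_homog] mult_monom)
lemma hom_cst [simp]: "hom 0 (cst a)"
  by (auto simp: hom_def coeff_pCons split: nat.splits)
lemma hom_one [simp]: "hom 0 1" by (metis hom_cst one_pCons)
lemma hom_power: "hom k p \<Longrightarrow> hom (k * n) (p ^ n)"
  by (induction n) (auto dest: hom_mult)
lemma hom_VX: "hom 1 VX" and hom_VY: "hom 1 VY" and hom_VZ: "hom 1 VZ"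
  by (auto simp: hom_def coeff_pCons split: nat.splits)
lemma hom_unique: "hom j p \<Longrightarrow> hom k p \<Longrightarrow> p \<noteq> 0 \<Longrightarrow> j = k"
  by (simp add: hom_iff_homog monom_eq_iff')

lemma hom_0_cst: assumes "hom 0 p" obtains a where "p = cst a"
proof
  show "p = cst (coeff3 p 0 0 0)"
  proof (rule poly3_eqI)
    fix i j l
    show "coeff3 p i j l = coeff3 (cst (coeff3 p 0 0 0)) i j l"
      using assms[unfolded hom_def, rule_format, of i j l] by (auto simp: coeff_pCons split: nat.splits)
  qed
qed

lemma cst_unit: "a \<noteq> 0 \<Longrightarrow> is_unit (cst a)"
  by (rule dvdI[of _ _ "cst (1 / a)"]) (simp add: one_pCons)

lemma hom_0_unit: "hom 0 p \<Longrightarrow> p \<noteq> 0 \<Longrightarrow> is_unit p"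
  by (metis hom_0_cst cst_unit pCons_0_0)

text \<open>Degree and order at 0 are additive over products and agree on a monomial. As the order
  never exceeds the degree, they agree on each factor too.\<close>

lemma monom_factor:
  fixes P Q :: "'a::idom poly"
  assumes "P * Q = monom c k" "c \<noteq> 0"
  obtains a m where "P = monom a m"
proof -
  have nz: "P \<noteq> 0" "Q \<noteq> 0" using assms by auto
  have "degree P + degree Q = k"
    using assms nz by (metis degree_mult_eq degree_monom_eq)
  moreover have "order 0 P + order 0 Q = k"
    using assms nz by (metis order_mult order_0_monom mult_eq_0_iff)
  moreover have "order 0 P \<le> degree P" "order 0 Q \<le> degree Q" using nz by (auto intro: order_degree)
  ultimately have "order 0 P = degree P" by linarith
  then have "monom 1 (degree P) dvd P" using monom_1_dvd_iff[OF nz(1)] by simp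
  then have "coeff P i = 0" if "i < degree P" for i
    using that monom_1_dvd_iff' by blast
  then have "P = monom (lead_coeff P) (degree P)"
    by (intro poly_eqI) (auto simp: not_less_iff_gr_or_eq coeff_eq_0 simp flip: neq_iff, metis coeff_eq_0 linorder_neqE_nat)
  then show thesis using that by blast
qed

text \<open>\<open>homog\<close> yields a factorization of a monomial in t over a domain, so both
  factors are monomials in t; setting t = 1 identifies their coefficients with \<open>p\<close> and
  \<open>q\<close>.\<close>

lemma hom_factor:
  assumes "hom k (p * q)" "p * q \<noteq> 0"
  obtains m n where "hom m p" "hom n q" "m + n = k"
proof -
  have eq: "homog p * homog q = monom (p * q) k"
    using assms by (simp add: hom_iff_homog is_ring_map_simps[OF ring_map_homog])
  obtain a m where m: "homog p = monom a m" using monom_factor[OF eq assms(2)] by blast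
  obtain b n where n: "homog q = monom b n"
    using monom_factor[of "homog q" "homog p"] eq assms(2) by (metis mult.commute)
  have "hom m p" "hom n q"
    using m n poly_homog_1[of p] poly_homog_1[of q] by (simp_all add: hom_iff_homog poly_monom)
  moreover from this have "m + n = k" using hom_mult hom_unique assms by blast
  ultimately show thesis using that by blast
qed

lemma hom_dvd: assumes "hom k q" "q \<noteq> 0" "p dvd q" obtains m where "hom m p" "m \<le> k"
proof -
  obtain r where "q = p * r" using assms(3) by (auto simp: dvd_def)
  with assms hom_factor[of k p r] that show thesis by (metis le_add1)
qed

lemma hom_cofactor:
  assumes "hom j p" "p \<noteq> 0" "hom (j + k) (p * q)" shows "hom k q"
proof (cases "q = 0")
  case False
  then obtain m n where "hom m p" "hom n q" "m + n = j + k"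
    using hom_factor[OF assms(3)] assms(2) by auto
  then show ?thesis using hom_unique[OF assms(1) _ assms(2)] by auto
qed simp

lemma hom_unit: assumes "hom k p" "is_unit p" shows "k = 0"
proof -
  have "p \<noteq> 0" using assms by auto
  obtain m where "hom m p" "m \<le> 0" using hom_dvd[OF hom_one _ assms(2)] by auto
  then show ?thesis using hom_unique[OF assms(1) _ \<open>p \<noteq> 0\<close>] by auto
qed

section \<open>Derivatives and Euler's formula\<close>

definition derivation :: "('a::comm_ring_1 \<Rightarrow> 'a) \<Rightarrow> bool" where
  "derivation D \<longleftrightarrow> (\<forall>a b. D (a + b) = D a + D b) \<and> (\<forall>a b. D (a * b) = a * D b + b * D a)"

lemma derivation_simps:
  assumes "derivation D"
  shows "D (a + b) = D a + D b" "D (a * b) = a * D b + b * D a" "D 0 = 0"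
proof -
  show a: "D (a + b) = D a + D b" "D (a * b) = a * D b + b * D a" for a b
    using assms by (auto simp: derivation_def)
  show "D 0 = 0" using a(1)[of 0 0] by simp
qed

lemma derivation_pderiv: "derivation (pderiv :: 'a::idom poly \<Rightarrow> _)"
  by (simp add: derivation_def pderiv_add pderiv_mult)

text \<open>Needed for \<open>dX\<close> and \<open>dY\<close>, which differentiate by inner
  variables and so act on coefficients.\<close>

lemma derivation_map_poly:
  assumes "derivation D" shows "derivation (map_poly D)"
proof -
  note D = derivation_simps[OF assms]
  have add: "map_poly D (p + q) = map_poly D p + map_poly D q" for p q
    by (rule poly_eqI) (simp add: coeff_map_poly D)
  have smult: "map_poly D (smult a q) = smult a (map_poly D q) + smult (D a) q" for a q
    by (rule poly_eqI) (simp add: coeff_map_poly D)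
  have "map_poly D (p * q) = p * map_poly D q + q * map_poly D p" for p q
    by (induction p) (simp_all add: add smult map_poly_pCons D algebra_simps)
  then show ?thesis using add by (simp add: derivation_def)
qed

lemma derivation_dX: "derivation dX" and derivation_dY: "derivation dY" and derivation_dZ: "derivation dZ"
  unfolding dX_def[abs_def] dY_def[abs_def] dZ_def[abs_def]
  by (intro derivation_map_poly derivation_pderiv)+

lemmas dX_simps = derivation_simps[OF derivation_dX]
lemmas dY_simps = derivation_simps[OF derivation_dY]
lemmas dZ_simps = derivation_simps[OF derivation_dZ]
lemmas d_simps = dX_simps dY_simps dZ_simps

lemma coeff3_dX: "coeff3 (dX p) i j l = of_nat (Suc l) * coeff3 p i j (Suc l)"
  and coeff3_dY: "coeff3 (dY p) i j l = of_nat (Suc j) * coeff3 p i (Suc j) l"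
  and coeff3_dZ: "coeff3 (dZ p) i j l = of_nat (Suc i) * coeff3 p (Suc i) j l"
  by (simp_all add: dX_def dY_def dZ_def coeff_map_poly coeff_pderiv of_nat_poly del: of_nat_Suc)

lemma hom_dX: "hom (Suc k) p \<Longrightarrow> hom k (dX p)"
  and hom_dY: "hom (Suc k) p \<Longrightarrow> hom k (dY p)"
  and hom_dZ: "hom (Suc k) p \<Longrightarrow> hom k (dZ p)"
  by (fastforce simp: hom_def coeff3_dX coeff3_dY coeff3_dZ simp del: of_nat_Suc)+

text \<open>The three products scale the coefficient of a monomial by its exponents in x, y and z,
  and these add up to \<open>k\<close> wherever the coefficient is nonzero.\<close>

lemma euler:
  assumes "hom k p"
  shows "VX * dX p + VY * dY p + VZ * dZ p = of_nat k * p"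
proof (rule poly3_eqI)
  fix i j l
  have "coeff3 (VX * dX p) i j l = of_nat l * coeff3 p i j l"
    by (cases l) (simp_all add: coeff_pCons coeff3_dX)
  moreover have "coeff3 (VY * dY p) i j l = of_nat j * coeff3 p i j l"
    by (cases j) (simp_all add: coeff_pCons coeff3_dY)
  moreover have "coeff3 (VZ * dZ p) i j l = of_nat i * coeff3 p i j l"
    by (cases i) (simp_all add: coeff_pCons coeff3_dZ)
  moreover have "coeff3 (of_nat k * p) i j l = of_nat k * coeff3 p i j l" by (simp add: of_nat_poly)
  moreover have "of_nat (i + j + l) * coeff3 p i j l = of_nat k * coeff3 p i j l"
    using assms by (cases "coeff3 p i j l = 0") (auto simp: hom_def)
  ultimately show "coeff3 (VX * dX p + VY * dY p + VZ * dZ p) i j l = coeff3 (of_nat k * p) i j l"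
    by (simp only: coeff_add) (simp add: algebra_simps)
qed

section \<open>Restriction to a line\<close>

lemma hom_ring_map:
  assumes "is_ring_map \<phi>" "\<And>a. \<phi> (cst a) = cst a" "hom 1 (\<phi> VX)" "hom 1 (\<phi> VY)" "hom 1 (\<phi> VZ)" "hom k p"
  shows "hom k (\<phi> p)"
  using assms(6)
proof (induction rule: hom_induct)
  case (mono a i j l)
  have "hom (0 + 1 * l + 1 * j + 1 * i) (\<phi> (mono3 a i j l))"
    unfolding ring_map_mono3[OF assms(1)] assms(2) by (intro hom_mult hom_power assms hom_cst)
  with mono show ?case by (simp add: algebra_simps)
qed (simp_all add: is_ring_map_simps[OF assms(1)] hom_add)

text \<open>The \<open>p\<close> congruent to their image modulo \<open>l\<close> are closed under
  sums and products, so constants and variables suffice.\<close>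

lemma ring_map_cong:
  assumes "is_ring_map \<phi>" "\<And>a. \<phi> (cst a) = cst a" "l dvd VX - \<phi> VX" "l dvd VY - \<phi> VY" "l dvd VZ - \<phi> VZ"
  shows "l dvd p - \<phi> p"
proof -
  note h = is_ring_map_simps[OF assms(1)]
  have mult: "l dvd p * q - \<phi> (p * q)" if "l dvd p - \<phi> p" "l dvd q - \<phi> q" for p q
  proof -
    have "p * q - \<phi> (p * q) = p * (q - \<phi> q) + \<phi> q * (p - \<phi> p)" by (simp add: h algebra_simps)
    then show ?thesis using that by simp
  qed
  have pow: "l dvd p ^ n - \<phi> (p ^ n)" if "l dvd p - \<phi> p" for p n
  proof (induction n)
    case (Suc n)
    then show ?case using mult[OF that, of "p ^ n"] by simp
  qed (simp add: h)
  show ?thesis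
  proof (induction p rule: poly3_induct)
    case (add p q)
    have "p + q - \<phi> (p + q) = (p - \<phi> p) + (q - \<phi> q)" by (simp add: h)
    then show ?case using add by (metis dvd_add)
  next
    case (mono a i j n)
    show ?case unfolding mono3_eq
      by (intro mult pow assms) (simp add: assms(2))
  qed (simp add: h)
qed

text \<open>Restriction to the line \<open>l = 0\<close>, as a substitution that eliminates one variable. Its values stay in
  \<open>poly3\<close>, so greatest common divisors on the line can be taken there.\<close>

definition line_restriction :: "poly3 \<Rightarrow> (poly3 \<Rightarrow> poly3) \<Rightarrow> bool" where
  "line_restriction l \<phi> \<longleftrightarrow> is_ring_map \<phi> \<and> (\<forall>p. l dvd p - \<phi> p) \<and> \<phi> l = 0 \<and> (\<forall>k p. hom k p \<longrightarrow> hom k (\<phi> p))"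

text \<open>Solve for a variable \<open>V\<close> with nonzero coefficient \<open>s\<close> in
  \<open>l\<close>: replace \<open>V\<close> by \<open>V - cst (1 / s) * l\<close> and keep the
  other two variables.\<close>

lemma line_restriction_exists:
  assumes l: "hom 1 l" "l \<noteq> 0"
  obtains \<phi> where "line_restriction l \<phi>"
proof -
  note claim = that
  \<comment> \<open>The coefficients of a linear form are its partial derivatives; Euler's formula
    reassembles \<open>l\<close> from them.\<close>
  have h0: "hom 0 (dX l)" "hom 0 (dY l)" "hom 0 (dZ l)"
    using l(1) hom_dX[of 0 l] hom_dY[of 0 l] hom_dZ[of 0 l] by simp_all
  obtain a b c where abc: "dX l = cst a" "dY l = cst b" "dZ l = cst c" using h0 hom_0_cst by metis
  have leq: "l = cst a * VX + cst b * VY + cst c * VZ"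
    using euler[OF l(1)] abc by (simp add: mult.commute)
  \<comment> \<open>Common to the three cases: \<open>m\<close> is the part of \<open>l\<close> free
    of \<open>V\<close>, so the substitution fixes it.\<close>
  have main: thesis
    if s: "l = cst s * V + m" "s \<noteq> 0" and f: "eval3 cst A B C m = m" "eval3 cst A B C V = V - cst (1 / s) * l"
      and ABC: "A = VX \<or> A = VX - cst (1 / s) * l" "B = VY \<or> B = VY - cst (1 / s) * l"
        "C = VZ \<or> C = VZ - cst (1 / s) * l" for s V m A B C
  proof -
    define \<phi> where "\<phi> = eval3 cst A B C"
    note f = f[folded \<phi>_def]
    have r: "is_ring_map \<phi>" unfolding \<phi>_def by (rule ring_map_eval3[OF ring_map_cst])
    have g: "\<phi> (cst u) = cst u" "\<phi> VX = A" "\<phi> VY = B" "\<phi> VZ = C" for u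
      unfolding \<phi>_def by (rule eval3_gens[OF ring_map_cst])+
    have "hom (0 + 1) (cst (1 / s) * l)" by (intro hom_mult hom_cst l)
    then have hs: "hom 1 (cst (1 / s) * l)" by simp
    have "hom 1 A" "hom 1 B" "hom 1 C" using ABC hom_VX hom_VY hom_VZ hs hom_diff by metis+
    then have homs: "\<forall>k p. hom k p \<longrightarrow> hom k (\<phi> p)" using hom_ring_map[OF r g(1)] g by simp
    have "l dvd VX - A" "l dvd VY - B" "l dvd VZ - C"
      using ABC by (auto simp del: mult_pCons_left)
    then have cong: "\<forall>p. l dvd p - \<phi> p" using ring_map_cong[OF r g(1)] g by simp
    have inv: "cst s * cst (1 / s) = 1" using s(2) by (simp add: one_pCons)
    have "\<phi> l = \<phi> (cst s) * \<phi> V + \<phi> m" using is_ring_map_simps[OF r] s(1) by metis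
    also have "\<dots> = cst s * V - (cst s * cst (1 / s)) * l + m"
      by (simp only: g f(1,2) right_diff_distrib mult.assoc)
    also have "\<dots> = (cst s * V + m) - l" unfolding inv by (simp only: mult_1 diff_add_eq)
    also have "\<dots> = 0" by (simp only: s(1)[symmetric] diff_self)
    finally show thesis using r claim[of \<phi>] homs cong by (simp add: line_restriction_def)
  qed
  note gens = eval3_gens[OF ring_map_cst] is_ring_map_simps[OF ring_map_eval3[OF ring_map_cst]]
  consider "a \<noteq> 0" | "b \<noteq> 0" | "c \<noteq> 0" using l(2) leq by fastforce
  then show thesis
  proof cases
    case 1
    show ?thesis
    proof (rule main[of a VX "cst b * VY + cst c * VZ" "VX - cst (1 / a) * l" VY VZ])
      show "l = cst a * VX + (cst b * VY + cst c * VZ)" by (subst leq) (simp only: ac_simps)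
    qed (use 1 in \<open>simp_all only: gens, simp_all only: simp_thms\<close>)
  next
    case 2
    show ?thesis
    proof (rule main[of b VY "cst a * VX + cst c * VZ" VX "VY - cst (1 / b) * l" VZ])
      show "l = cst b * VY + (cst a * VX + cst c * VZ)" by (subst leq) (simp only: ac_simps)
    qed (use 2 in \<open>simp_all only: gens, simp_all only: simp_thms\<close>)
  next
    case 3
    show ?thesis
    proof (rule main[of c VZ "cst a * VX + cst b * VY" VX VY "VZ - cst (1 / c) * l"])
      show "l = cst c * VZ + (cst a * VX + cst b * VY)" by (subst leq) (simp only: ac_simps)
    qed (use 3 in \<open>simp_all only: gens, simp_all only: simp_thms\<close>)
  qed
qed

text \<open>The kernel of \<open>\<phi>\<close> is the ideal of \<open>l\<close>, since
  \<open>p\<close> and \<open>\<phi> p\<close> differ by a multiple of \<open>l\<close> and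
  \<open>\<phi>\<close> kills such multiples. This also makes \<open>\<phi>\<close>
  idempotent.\<close>

lemma line_restriction_facts:
  assumes "line_restriction l \<phi>"
  shows "is_ring_map \<phi>" "l dvd p - \<phi> p" "l dvd p \<longleftrightarrow> \<phi> p = 0" "\<phi> (\<phi> p) = \<phi> p" "hom k p \<Longrightarrow> hom k (\<phi> p)"
proof -
  show r: "is_ring_map \<phi>" and 1: "l dvd p - \<phi> p" and "hom k p \<Longrightarrow> hom k (\<phi> p)" for p
    using assms by (auto simp: line_restriction_def)
  show 2: "l dvd p \<longleftrightarrow> \<phi> p = 0" for p
  proof
    assume "l dvd p" then show "\<phi> p = 0"
      using assms is_ring_map_simps[OF r] by (auto simp: line_restriction_def dvd_def)
  qed (use 1[of p] in simp)
  show "\<phi> (\<phi> p) = \<phi> p" using 1[of p] 2[of "p - \<phi> p"] is_ring_map_simps[OF r] by simp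
qed

text \<open>The kernel of a ring map into a domain is prime.\<close>

lemma linear_prime:
  assumes "hom 1 l" "l \<noteq> 0" "l dvd p * q" shows "l dvd p \<or> l dvd q"
proof -
  obtain \<phi> where e: "line_restriction l \<phi>" using line_restriction_exists assms by blast
  then show ?thesis using assms(3) line_restriction_facts(3)[OF e] is_ring_map_simps[OF line_restriction_facts(1)[OF e]] by simp
qed

lemma coprime_syzygy:
  fixes b1 b2 u v :: "'a::{factorial_ring_gcd,ring_gcd}"
  assumes "coprime b1 b2" "u * b1 + v * b2 = 0"
  obtains w where "u = w * b2" "v = - (w * b1)"
proof -
  have eq: "u * b1 = - v * b2" using assms(2) by (simp add: eq_neg_iff_add_eq_0)
  have "b2 dvd u * b1" using eq by simp
  then have "b2 dvd u" using assms(1) by (metis coprime_commute coprime_dvd_mult_left_iff)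
  then obtain w where w: "u = w * b2" by (metis dvd_div_mult_self)
  show thesis
  proof (cases "b2 = 0")
    \<comment> \<open>Here \<open>u = 0\<close> while \<open>v\<close> is arbitrary; the inverse
      \<open>c\<close> of \<open>b1\<close> produces the witness.\<close>
    case True
    then have "is_unit b1" using assms(1) by simp
    then obtain c where "1 = b1 * c" by (auto simp: dvd_def)
    moreover have "u = 0" using w True by simp
    ultimately show thesis using that[of "- v * c"] True by (simp add: algebra_simps)
  next
    case False
    have "(w * b1 + v) * b2 = 0" using assms(2) w by (simp add: algebra_simps)
    then have "w * b1 + v = 0" using False by simp
    then have "v = - (w * b1)" by (simp add: eq_neg_iff_add_eq_0 add.commute)
    then show thesis using that w by blast
  qed
qed

text \<open>On the line the two forms have a greatest common divisor, of degree \<open>e\<close>,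
  with coprime cofactors \<open>b1\<close> and \<open>b2\<close>; the syzygies are the multiples of
  \<open>(b2, - b1)\<close>. A zero cofactor carries no degree information, hence the
  implications.\<close>

lemma syzygies_mod_linear:
  assumes l: "hom 1 l" "l \<noteq> 0" and a: "hom d1 a1" "hom d2 a2" and nz: "\<not> l dvd a1 \<or> \<not> l dvd a2"
  obtains b1 b2 e where "b1 \<noteq> 0 \<longrightarrow> e \<le> d1 \<and> hom (d1 - e) b1" "b2 \<noteq> 0 \<longrightarrow> e \<le> d2 \<and> hom (d2 - e) b2"
    "coprime b1 b2" "l dvd b2 * a1 - b1 * a2"
    "\<forall>u v. l dvd u * a1 + v * a2 \<longrightarrow> (\<exists>w u' v'. u = w * b2 + u' * l \<and> v = v' * l - w * b1)"
proof -
  obtain \<phi> where e: "line_restriction l \<phi>" using line_restriction_exists l by blast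
  note E = line_restriction_facts[OF e] and R = is_ring_map_simps[OF line_restriction_facts(1)[OF e]]
  define g where "g = gcd (\<phi> a1) (\<phi> a2)"
  have gnz: "g \<noteq> 0" using nz E(3) by (simp add: g_def)
  obtain c1 c2 where c: "\<phi> a1 = g * c1" "\<phi> a2 = g * c2" unfolding g_def by (meson dvdE gcd_dvd1 gcd_dvd2)
  \<comment> \<open>The cofactors of \<open>g\<close> are not known to be fixed by
    \<open>\<phi>\<close>. Restricting once more, with \<open>\<phi>\<close> idempotent, replaces
    \<open>g\<close> by \<open>\<phi> g\<close> and keeps the products.\<close>
  define b1 b2 where b: "b1 = \<phi> c1" "b2 = \<phi> c2"
  have fa: "\<phi> a1 = \<phi> g * b1" "\<phi> a2 = \<phi> g * b2" using c b R E(4) by metis+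
  have fgnz: "\<phi> g \<noteq> 0" using fa nz E(3) by auto
  \<comment> \<open>\<open>\<phi> g\<close> is a common divisor, so it divides \<open>g\<close>;
    both have degree \<open>m\<close>, so the cofactor \<open>w\<close> is a unit and
    \<open>\<phi> g\<close> serves as greatest common divisor.\<close>
  obtain w where w: "g = \<phi> g * w" using fa unfolding g_def by (metis dvdE dvd_triv_left gcd_greatest)
  obtain m where m: "hom m g"
  proof (cases "\<phi> a1 = 0")
    case True
    then have "\<phi> a2 \<noteq> 0" using nz E(3) by simp
    then show ?thesis using that hom_dvd[OF E(5)[OF a(2)]] by (auto simp: g_def)
  next
    case False
    then show ?thesis using that hom_dvd[OF E(5)[OF a(1)]] by (auto simp: g_def)
  qed
  have m': "hom m (\<phi> g)" using m E(5) by blast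
  have "hom 0 w" by (rule hom_cofactor[OF m' fgnz]) (use m w in simp)
  then have unit: "is_unit w" using hom_0_unit w gnz by force
  have cop: "coprime b1 b2"
  proof (rule coprimeI)
    fix t assume "t dvd b1" "t dvd b2"
    then have "\<phi> g * t dvd \<phi> g * w" using w by (metis fa g_def gcd_greatest mult_dvd_mono dvd_refl)
    then show "is_unit t" using fgnz unit by (metis dvd_mult_cancel_left dvd_trans)
  qed
  have homb: "m \<le> d \<and> hom (d - m) b" if bd: "b \<noteq> 0" "hom d (\<phi> g * b)" for d b
  proof -
    obtain i j where "hom i (\<phi> g)" "hom j b" "i + j = d" using hom_factor[OF bd(2)] bd(1) fgnz by auto
    moreover from this have "i = m" using hom_unique m' fgnz by blast
    ultimately show ?thesis by auto
  qed
  have fb: "\<phi> b1 = b1" "\<phi> b2 = b2" using E(4) b by simp_all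
  show thesis
  proof (rule that[OF _ _ cop])
    show "b1 \<noteq> 0 \<longrightarrow> m \<le> d1 \<and> hom (d1 - m) b1" using homb[of b1 d1] fa a E(5) by metis
    show "b2 \<noteq> 0 \<longrightarrow> m \<le> d2 \<and> hom (d2 - m) b2" using homb[of b2 d2] fa a E(5) by metis
    show "l dvd b2 * a1 - b1 * a2" by (simp add: E(3) R fa fb)
    show "\<forall>u v. l dvd u * a1 + v * a2 \<longrightarrow> (\<exists>w u' v'. u = w * b2 + u' * l \<and> v = v' * l - w * b1)"
    proof (intro allI impI)
      fix u v assume "l dvd u * a1 + v * a2"
      \<comment> \<open>Restriction turns the congruence into an equation, from which
        \<open>\<phi> g\<close> cancels.\<close>
      then have "\<phi> g * (\<phi> u * b1 + \<phi> v * b2) = 0" by (simp add: E(3) R fa algebra_simps)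
      then have "\<phi> u * b1 + \<phi> v * b2 = 0" using fgnz by simp
      then obtain s where s: "\<phi> u = s * b2" "\<phi> v = - (s * b1)" using coprime_syzygy[OF cop] by metis
      obtain u' v' where "u - \<phi> u = u' * l" "v - \<phi> v = v' * l" using E(2) by (metis dvd_def mult.commute)
      then show "\<exists>w u' v'. u = w * b2 + u' * l \<and> v = v' * l - w * b1"
        using s by (intro exI[of _ s] exI[of _ u'] exI[of _ v']) (simp add: algebra_simps)
    qed
  qed
qed

section \<open>The gradient of a squarefree form\<close>

lemma gradient_nonzero:
  assumes "hom d f" "d > 0" "f \<noteq> 0" shows "dX f \<noteq> 0 \<or> dY f \<noteq> 0 \<or> dZ f \<noteq> 0"
  using euler[OF assms(1)] assms(2,3) by auto

text \<open>A common prime factor \<open>p\<close> divides \<open>f\<close> by Euler's formula, and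
  only once because \<open>f\<close> is squarefree. With \<open>f = p * k\<close> the product rule
  makes \<open>p\<close> divide its own partial derivatives, which have smaller degree and so
  vanish, against Euler's formula for \<open>p\<close>.\<close>

lemma gradient_coprime:
  assumes f: "hom d f" "d > 0" "squarefree f" and t: "t dvd dX f" "t dvd dY f" "t dvd dZ f"
  shows "is_unit t"
proof (rule ccontr)
  assume nu: "\<not> is_unit t"
  have fnz: "f \<noteq> 0" using f(3) by auto
  have "t \<noteq> 0" using gradient_nonzero[OF f(1,2) fnz] t by auto
  then obtain p where p: "prime p" "p dvd t" using nu prime_divisorE by blast
  then have pd: "p dvd dX f" "p dvd dY f" "p dvd dZ f" using t dvd_trans by blast+
  have "is_unit (of_nat d :: poly3)"
    using f(2) cst_unit[of "of_nat d"] by (simp add: of_nat_poly)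
  moreover have "p dvd of_nat d * f" unfolding euler[OF f(1), symmetric] using pd by (intro dvd_add dvd_mult)
  ultimately have "p dvd f" by (simp add: dvd_mult_unit_iff')
  then obtain k where k: "f = p * k" by (auto simp: dvd_def)
  have nk: "\<not> p dvd k"
  proof
    assume "p dvd k" then have "p ^ 2 dvd f" by (simp add: k power2_eq_square mult_dvd_mono)
    then show False using f(3) p(1) squarefreeD not_prime_unit by blast
  qed
  have pnz: "p \<noteq> 0" using p by auto
  obtain e where e: "hom e p" using hom_dvd[OF f(1) fnz \<open>p dvd f\<close>] by blast
  have epos: "e > 0" using hom_0_unit[of p] e p pnz by (metis gr0I not_prime_unit)
  then obtain e' where e': "e = Suc e'" by (cases e) auto
  have zero: "q = 0" if q': "hom e' q" "p dvd q" for q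
  proof (rule ccontr)
    assume q: "q \<noteq> 0"
    obtain n where "hom n p" "n \<le> e'" using hom_dvd[OF q'(1) q q'(2)] by blast
    then show False using hom_unique[OF e _ pnz, of n] e' by simp
  qed
  have "p dvd dX p" "p dvd dY p" "p dvd dZ p"
    using pd nk p(1) unfolding k d_simps by (metis dvd_add_right_iff dvd_triv_left prime_dvd_multD)+
  then have "dX p = 0" "dY p = 0" "dZ p = 0"
    using zero hom_dX hom_dY hom_dZ e e' by blast+
  then show False using gradient_nonzero[OF e epos pnz] by simp
qed

section \<open>Syzygies of the gradient\<close>

text \<open>A triple is read as a derivation of S, so that \<open>D0 f\<close> consists of the
  derivations that kill \<open>f\<close>.\<close>

definition act :: "trip \<Rightarrow> poly3 \<Rightarrow> poly3" where
  "act v p = fst v * dX p + fst (snd v) * dY p + snd (snd v) * dZ p"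

definition smul :: "poly3 \<Rightarrow> trip \<Rightarrow> trip" where
  "smul p v = (p * fst v, p * fst (snd v), p * snd (snd v))"

abbreviation EE :: trip where "EE \<equiv> (VX, VY, VZ)"

lemma D0_iff: "v \<in> D0 f \<longleftrightarrow> act v f = 0"
  by (cases v) (simp add: D0_def act_def)

lemma act_simps:
  "act 0 p = 0" "act (v + w) p = act v p + act w p" "act (v - w) p = act v p - act w p" "act (- v) p = - act v p"
  "act (smul q v) p = q * act v p" "act v (p * q) = p * act v q + q * act v p"
  by (simp_all add: act_def smul_def d_simps algebra_simps)

lemma act_euler: "hom k p \<Longrightarrow> act EE p = of_nat k * p"
  unfolding act_def fst_conv snd_conv by (rule euler)

lemma htrip_diff: "htrip k v \<Longrightarrow> htrip k w \<Longrightarrow> htrip k (v - w)"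
  and htrip_smul: "hom j p \<Longrightarrow> htrip k v \<Longrightarrow> htrip (j + k) (smul p v)"
  by (simp_all add: htrip_def smul_def hom_diff hom_mult)

lemma htrip_0 [simp]: "htrip k 0" by (simp add: htrip_def)

lemma smul_0 [simp]: "smul 0 v = 0" by (simp add: smul_def prod_eq_iff)

lemma htrip_EE: "htrip 1 EE"
  unfolding htrip_def fst_conv snd_conv using hom_VX hom_VY hom_VZ by blast

lemma hom_act_linear:
  assumes "htrip k v" "hom 1 l" shows "hom k (act v l)"
proof -
  have "hom 0 (dX l)" "hom 0 (dY l)" "hom 0 (dZ l)"
    using assms(2) hom_dX[of 0 l] hom_dY[of 0 l] hom_dZ[of 0 l] by simp_all
  then show ?thesis using assms(1) hom_mult[of k _ 0] unfolding act_def htrip_def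
    by (intro hom_add) force+
qed

section \<open>Generating systems with two or three members\<close>

lemma span3_2: "span3 [g1, g2] = {smul p g1 + smul q g2 |p q. True}"
proof (intro equalityI subsetI)
  fix v assume "v \<in> span3 [g1, g2]"
  then show "v \<in> {smul p g1 + smul q g2 |p q. True}"
    by (auto simp: span3_def smul_def lessThan_Suc numeral_2_eq_2 add.commute)
next
  fix v assume "v \<in> {smul p g1 + smul q g2 |p q. True}"
  then obtain p q where "v = smul p g1 + smul q g2" by blast
  then show "v \<in> span3 [g1, g2]"
    unfolding span3_def
    by (intro CollectI exI[of _ "\<lambda>i. [p, q] ! i"]) (simp add: smul_def numeral_2_eq_2 add.commute)
qed

lemma span3_3: "span3 [g1, g2, g3] = {smul p g1 + smul q g2 + smul r g3 |p q r. True}"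
proof (intro equalityI subsetI)
  fix v assume "v \<in> span3 [g1, g2, g3]"
  then obtain rs :: "nat \<Rightarrow> poly3"
    where "v = smul (rs 0) g1 + smul (rs (Suc 0)) g2 + smul (rs (Suc (Suc 0))) g3"
    by (auto simp: span3_def smul_def numeral_2_eq_2 numeral_3_eq_3)
  then show "v \<in> {smul p g1 + smul q g2 + smul r g3 |p q r. True}" by blast
next
  fix v assume "v \<in> {smul p g1 + smul q g2 + smul r g3 |p q r. True}"
  then obtain p q r where "v = smul p g1 + smul q g2 + smul r g3" by blast
  then show "v \<in> span3 [g1, g2, g3]"
    unfolding span3_def
    by (intro CollectI exI[of _ "\<lambda>i. [p, q, r] ! i"]) (simp add: smul_def numeral_2_eq_2 numeral_3_eq_3 ac_simps)
qed

lemma hom_gen_sys_2: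
  "hom_gen_sys f [g1, g2] [k1, k2] \<longleftrightarrow> htrip k1 g1 \<and> htrip k2 g2 \<and> g1 \<noteq> 0 \<and> g2 \<noteq> 0 \<and>
    (\<forall>v. v \<in> D0 f \<longleftrightarrow> (\<exists>p q. v = smul p g1 + smul q g2))"
proof -
  have "span3 [g1, g2] = D0 f \<longleftrightarrow> (\<forall>v. v \<in> D0 f \<longleftrightarrow> (\<exists>p q. v = smul p g1 + smul q g2))"
    unfolding span3_2 by blast
  then show ?thesis by (auto simp: hom_gen_sys_def zero_prod_def less_Suc_eq simp del: split_paired_All)
qed

lemma hom_gen_sys_3:
  "hom_gen_sys f [g1, g2, g3] [k1, k2, k3] \<longleftrightarrow> htrip k1 g1 \<and> htrip k2 g2 \<and> htrip k3 g3 \<and>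
    g1 \<noteq> 0 \<and> g2 \<noteq> 0 \<and> g3 \<noteq> 0 \<and>
    (\<forall>v. v \<in> D0 f \<longleftrightarrow> (\<exists>p q r. v = smul p g1 + smul q g2 + smul r g3))"
proof -
  have "span3 [g1, g2, g3] = D0 f \<longleftrightarrow>
      (\<forall>v. v \<in> D0 f \<longleftrightarrow> (\<exists>p q r. v = smul p g1 + smul q g2 + smul r g3))"
    unfolding span3_3 by blast
  then show ?thesis by (auto simp: hom_gen_sys_def zero_prod_def less_Suc_eq simp del: split_paired_All)
qed

section \<open>A lower bound for the number of generators, and Saito's criterion\<close>

lemma koszul:
  "(dY f, - dX f, 0) \<in> D0 f" "(dZ f, 0, - dX f) \<in> D0 f" "(0, dZ f, - dY f) \<in> D0 f"
  by (simp_all add: D0_def)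

text \<open>The three Koszul syzygies cannot all be multiples of one triple unless the gradient
  vanishes.\<close>

lemma two_le_length_gens:
  assumes "hom d f" "d > 0" "f \<noteq> 0" "hom_gen_sys f gs ds"
  shows "2 \<le> length gs"
proof (rule ccontr)
  assume "\<not> 2 \<le> length gs"
  then consider "gs = []" | g where "gs = [g]"
    by (cases gs) (auto simp: Suc_le_eq)
  then obtain x y z where "span3 gs \<subseteq> {smul p (x, y, z) |p. True}"
  proof cases
    case 1
    then have "span3 gs \<subseteq> {smul p (0, 0, 0) |p. True}" by (auto simp: span3_def smul_def)
    then show thesis using that by blast
  next
    case (2 g)
    then have "span3 gs \<subseteq> {smul p (fst g, fst (snd g), snd (snd g)) |p. True}"
      by (auto simp: span3_def smul_def)
    then show thesis using that by blast
  qed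
  then have span: "\<exists>p. v = smul p (x, y, z)" if "v \<in> D0 f" for v
    using assms(4) that by (auto simp: hom_gen_sys_def)
  obtain p q r where "(dY f, - dX f, 0) = smul p (x, y, z)" "(dZ f, 0, - dX f) = smul q (x, y, z)"
    "(0, dZ f, - dY f) = smul r (x, y, z)"
    using koszul[of f, THEN span] by blast
  then have e: "dY f = p * x" "- dX f = p * y" "0 = p * z" "dZ f = q * x" "0 = q * y" "- dX f = q * z"
    "0 = r * x" "dZ f = r * y" "- dY f = r * z"
    unfolding smul_def prod.inject fst_conv snd_conv by blast+
  \<comment> \<open>\<open>p * z = 0\<close> leaves \<open>p = 0\<close> or \<open>z = 0\<close>,
    and either one kills \<open>dX f\<close> and \<open>dY f\<close>; \<open>q * y = 0\<close> does
    the same for \<open>dZ f\<close>.\<close>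
  have "dX f = 0" using e(2,3,6) by (metis mult_eq_0_iff neg_equal_0_iff_equal)
  moreover have "dY f = 0" using e(1,3,9) by (metis mult_eq_0_iff neg_equal_0_iff_equal)
  moreover have "dZ f = 0" using e(4,5,8) by (metis mult_eq_0_iff)
  ultimately have "dX f = 0 \<and> dY f = 0 \<and> dZ f = 0" by blast
  then show False using gradient_nonzero[OF assms(1-3)] by simp
qed

text \<open>Cross products of Koszul syzygies are a partial derivative times the gradient, and also
  multiples of the cross product \<open>(P, Q, R)\<close> of the two triples. As the partial
  derivatives have no common factor, the two scalars differ by a unit.\<close>

lemma saito:
  fixes x1 y1 z1 x2 y2 z2 :: poly3
  assumes f: "hom d f" "d > 0" "squarefree f"
    and span: "\<And>v. v \<in> D0 f \<Longrightarrow> \<exists>p q. v = smul p (x1, y1, z1) + smul q (x2, y2, z2)"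
  obtains h where "is_unit h" "y1 * z2 - z1 * y2 = h * dX f" "z1 * x2 - x1 * z2 = h * dY f"
    "x1 * y2 - y1 * x2 = h * dZ f"
proof -
  define P Q R where PQR: "P = y1 * z2 - z1 * y2" "Q = z1 * x2 - x1 * z2" "R = x1 * y2 - y1 * x2"
  have "f \<noteq> 0" using f(3) by auto
  then have nz: "dX f \<noteq> 0 \<or> dY f \<noteq> 0 \<or> dZ f \<noteq> 0" using gradient_nonzero f by blast
  have cross: "\<exists>\<alpha>. b * c' - c * b' = \<alpha> * P \<and> c * a' - a * c' = \<alpha> * Q \<and> a * b' - b * a' = \<alpha> * R"
    if v: "(a, b, c) \<in> D0 f" "(a', b', c') \<in> D0 f" for a b c a' b' c'
  proof -
    obtain p q p' q' where "(a, b, c) = smul p (x1, y1, z1) + smul q (x2, y2, z2)"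
      "(a', b', c') = smul p' (x1, y1, z1) + smul q' (x2, y2, z2)" using span v by metis
    \<comment> \<open>The scalar is the determinant of the coordinates of the two syzygies.\<close>
    then show ?thesis
      by (intro exI[of _ "p * q' - q * p'"]) (simp add: smul_def PQR algebra_simps)
  qed
  have par: "\<exists>\<alpha>. g * dX f = \<alpha> * P \<and> g * dY f = \<alpha> * Q \<and> g * dZ f = \<alpha> * R"
    if "g \<in> {dX f, dY f, dZ f}" for g
    using that cross[OF koszul(1,2)] cross[OF koszul(1,3)] cross[OF koszul(2,3)]
    by (auto simp: mult.commute)
  have dvdI: "\<alpha> dvd g" if "\<alpha> dvd g * dX f" "\<alpha> dvd g * dY f" "\<alpha> dvd g * dZ f" for \<alpha> g
  proof -
    have "is_unit (gcd (dX f) (gcd (dY f) (dZ f)))"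
      using gradient_coprime[OF f] by (meson dvd_trans gcd_dvd1 gcd_dvd2)
    then have 1: "gcd (dX f) (gcd (dY f) (dZ f)) = 1" using is_unit_gcd_iff by blast
    have "\<alpha> dvd gcd (g * dY f) (g * dZ f)" using that by simp
    then have "\<alpha> dvd g * gcd (dY f) (dZ f)" by (simp only: gcd_mult_left dvd_normalize_iff)
    with that(1) have "\<alpha> dvd gcd (g * dX f) (g * gcd (dY f) (dZ f))" by (rule gcd_greatest)
    then have "\<alpha> dvd g * gcd (dX f) (gcd (dY f) (dZ f))" by (simp only: gcd_mult_left dvd_normalize_iff)
    then show ?thesis unfolding 1 by simp
  qed
  obtain g where g: "g \<in> {dX f, dY f, dZ f}" "g \<noteq> 0" using nz by blast
  obtain \<alpha> where \<alpha>: "g * dX f = \<alpha> * P" "g * dY f = \<alpha> * Q" "g * dZ f = \<alpha> * R"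
    using par[OF g(1)] by blast
  then have "\<alpha> dvd g" using dvdI by simp
  then obtain h where h: "g = \<alpha> * h" by (auto simp: dvd_def)
  then have P: "P = h * dX f" "Q = h * dY f" "R = h * dZ f"
    using \<alpha> g(2) by (auto simp: mult.assoc)
  \<comment> \<open>The same relation for any partial derivative \<open>g'\<close> gives
    \<open>g' = \<beta> * h\<close>, so \<open>h\<close> divides the whole gradient.\<close>
  have "h dvd g'" if g': "g' \<in> {dX f, dY f, dZ f}" for g'
  proof -
    obtain \<beta> where "g' * dX f = \<beta> * P" "g' * dY f = \<beta> * Q" "g' * dZ f = \<beta> * R"
      using par[OF g'] by blast
    then have "(g' - \<beta> * h) * dX f = 0 \<and> (g' - \<beta> * h) * dY f = 0 \<and> (g' - \<beta> * h) * dZ f = 0"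
      unfolding P by (simp add: left_diff_distrib mult.assoc)
    then have "g' = \<beta> * h" using nz by auto
    then show ?thesis by simp
  qed
  then have "is_unit h" using gradient_coprime[OF f] by simp
  then show thesis by (rule that) (simp_all only: PQR[symmetric] P)
qed

text \<open>In Saito's identity the minors have degree \<open>d1 + d2\<close>, the partial
  derivatives \<open>d - 1\<close>, and the unit 0. The coefficients of a relation between
  \<open>r1\<close> and \<open>r2\<close> are annihilated by all minors, as in Cramer's rule, and
  some minor is nonzero.\<close>

lemma free_exponents:
  assumes f: "hom d f" "d > 0" "squarefree f" and sys: "hom_gen_sys f [r1, r2] [d1, d2]"
  shows "d1 + d2 + 1 = d" and "\<And>p q. smul p r1 + smul q r2 = 0 \<Longrightarrow> p = 0 \<and> q = 0"
proof -
  obtain x1 y1 z1 x2 y2 z2 where r: "r1 = (x1, y1, z1)" "r2 = (x2, y2, z2)" by (metis prod_cases3)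
  obtain h where h: "is_unit h" "y1 * z2 - z1 * y2 = h * dX f" "z1 * x2 - x1 * z2 = h * dY f"
    "x1 * y2 - y1 * x2 = h * dZ f"
    using saito[OF f, of x1 y1 z1 x2 y2 z2] sys unfolding hom_gen_sys_2 r by blast
  have "f \<noteq> 0" using f(3) by auto
  then have nz: "dX f \<noteq> 0 \<or> dY f \<noteq> 0 \<or> dZ f \<noteq> 0" using gradient_nonzero f by blast
  have hnz: "h \<noteq> 0" using h(1) by auto
  obtain m where m: "d = Suc m" using f(2) by (cases d) auto
  have hr: "hom d1 x1" "hom d1 y1" "hom d1 z1" "hom d2 x2" "hom d2 y2" "hom d2 z2"
    using sys unfolding hom_gen_sys_2 r htrip_def by auto
  have prod: "hom (d1 + d2) (p * q)" "hom (d1 + d2) (q * p)" if "hom d1 p" "hom d2 q" for p q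
    using hom_mult[OF that] by (simp_all add: mult.commute)
  have deg: "d1 + d2 = m" if g: "hom m g" "g \<noteq> 0" "hom (d1 + d2) (h * g)" for g
  proof -
    obtain i j where ij: "hom i h" "hom j g" "i + j = d1 + d2" using hom_factor[OF g(3)] hnz g(2) by auto
    then show ?thesis using hom_unit[OF ij(1) h(1)] hom_unique[OF ij(2) g(1,2)] by simp
  qed
  have "hom (d1 + d2) (h * dX f)" "hom (d1 + d2) (h * dY f)" "hom (d1 + d2) (h * dZ f)"
    unfolding h(2-4)[symmetric] by (intro hom_diff prod hr)+
  moreover have "hom m (dX f)" "hom m (dY f)" "hom m (dZ f)" using f(1) m hom_dX hom_dY hom_dZ by blast+
  ultimately show "d1 + d2 + 1 = d" using nz deg m by fastforce
  fix p q assume "smul p r1 + smul q r2 = 0"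
  then have e: "p * x1 = - q * x2" "p * y1 = - q * y2" "p * z1 = - q * z2"
    by (simp_all add: r smul_def zero_prod_def eq_neg_iff_add_eq_0)
  have "p * (h * dX f) = 0" "p * (h * dY f) = 0" "p * (h * dZ f) = 0"
    "q * (h * dX f) = 0" "q * (h * dY f) = 0" "q * (h * dZ f) = 0"
    unfolding h(2-4)[symmetric] using e by algebra+
  then show "p = 0 \<and> q = 0" using nz hnz by auto
qed

section \<open>Adding a line to a free curve\<close>

lemma mingens_2:
  assumes "hom d f" "d > 0" "f \<noteq> 0" "hom_gen_sys f [g1, g2] [k1, k2]"
  shows "mingens f 2"
  unfolding mingens_def
proof (intro conjI allI impI)
  show "\<exists>gs ds. hom_gen_sys f gs ds \<and> length gs = 2"
    using assms(4) by (intro exI[of _ "[g1, g2]"] exI[of _ "[k1, k2]"]) simp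
qed (rule two_le_length_gens[OF assms(1-3)])

text \<open>A system of two generators would be minimal by the lower bound and so give
  \<open>mingens f 2\<close>.\<close>

lemma mingens_3:
  assumes "hom d f" "d > 0" "f \<noteq> 0" "hom_gen_sys f [g1, g2, g3] [k1, k2, k3]" "\<not> mingens f 2"
  shows "mingens f 3"
  unfolding mingens_def
proof (intro conjI allI impI)
  show "\<exists>gs ds. hom_gen_sys f gs ds \<and> length gs = 3"
    using assms(4) by (intro exI[of _ "[g1, g2, g3]"] exI[of _ "[k1, k2, k3]"]) simp
next
  fix gs ds assume sys: "hom_gen_sys f gs ds"
  have "length gs \<noteq> 2"
    using sys assms(5) two_le_length_gens[OF assms(1-3)] unfolding mingens_def by blast
  then show "3 \<le> length gs" using two_le_length_gens[OF assms(1-3) sys] by simp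
qed

text \<open>Here \<open>d + 1\<close> is the degree of \<open>f * l\<close>, and \<open>s\<close> is
  meant to be the cofactor in \<open>act v l = s * l\<close>. As a separate argument it makes the
  map linear in the pair \<open>(v, s)\<close>.\<close>

definition line_lift :: "nat \<Rightarrow> trip \<Rightarrow> poly3 \<Rightarrow> trip" where
  "line_lift d v s = v - smul (cst (1 / of_nat (d + 1)) * s) EE"

lemma line_lift_comb:
  "line_lift d (smul p u + smul q v + smul r w) (p * a + q * b + r * c) =
    smul p (line_lift d u a) + smul q (line_lift d v b) + smul r (line_lift d w c)"
proof -
  define k where "k = cst (1 / of_nat (d + 1))"
  show ?thesis unfolding line_lift_def k_def[symmetric]
    by (simp add: smul_def prod_eq_iff algebra_simps del: mult_pCons_left mult_pCons_right)
qed

lemma cst_inverse: "cst (1 / of_nat (d + 1)) * of_nat (d + 1) = 1"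
  by (simp add: of_nat_poly one_pCons del: of_nat_add of_nat_Suc)

text \<open>\<open>v\<close> multiplies \<open>f * l\<close> by \<open>s\<close>, and
  \<open>EE\<close> multiplies it by \<open>d + 1\<close>, so the correction cancels.\<close>

lemma line_lift_in_D0:
  assumes "hom d f" "hom 1 l" "v \<in> D0 f" "act v l = s * l"
  shows "line_lift d v s \<in> D0 (f * l)"
proof -
  define k where "k = cst (1 / of_nat (d + 1))"
  have k: "k * of_nat (d + 1) = 1" unfolding k_def by (rule cst_inverse)
  have "act EE (f * l) = of_nat (d + 1) * (f * l)" by (rule act_euler hom_mult assms)+
  moreover have "act v (f * l) = f * (s * l)" using assms(3,4) by (simp add: D0_iff act_simps)
  moreover have "act (line_lift d v s) (f * l) = act v (f * l) - k * s * act EE (f * l)"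
    by (simp only: line_lift_def k_def act_simps(3,5))
  ultimately have "act (line_lift d v s) (f * l) = f * (s * l) - (k * of_nat (d + 1)) * s * (f * l)"
    by (simp only: ac_simps)
  then show ?thesis unfolding k by (simp add: D0_iff algebra_simps)
qed

text \<open>The product rule and primality of \<open>l\<close> give \<open>act v l = l * h\<close>
  and \<open>act v f = - (f * h)\<close>. Adding \<open>m * h\<close> times \<open>EE\<close>, where
  \<open>m\<close> is the inverse of \<open>d\<close>, kills \<open>f\<close>.\<close>

lemma D0_mult_linear:
  assumes f: "hom d f" "d > 0" and l: "hom 1 l" "l \<noteq> 0" and nd: "\<not> l dvd f" and v: "v \<in> D0 (f * l)"
  obtains w s where "w \<in> D0 f" "act w l = s * l" "v = line_lift d w s"
proof -
  define k where "k = cst (1 / of_nat (d + 1))"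
  define m where "m = cst (1 / of_nat d)"
  have k: "k * of_nat (d + 1) = 1" unfolding k_def by (rule cst_inverse)
  have m: "m * of_nat d = 1" unfolding m_def using f(2) cst_inverse[of "d - 1"] by simp
  have eq: "f * act v l + l * act v f = 0" using v by (simp add: D0_iff act_simps)
  then have "f * act v l = l * (- act v f)" by (simp add: eq_neg_iff_add_eq_0)
  then have "l dvd f * act v l" by simp
  then have "l dvd act v l" using linear_prime[OF l] nd by blast
  then obtain h where h: "act v l = l * h" by (rule dvdE)
  then have "l * (f * h + act v f) = 0" using eq by (simp add: algebra_simps)
  then have vf: "f * h + act v f = 0" using l(2) by simp
  define w where "w = v + smul (m * h) EE"
  have "act w f = act v f + (m * of_nat d) * h * f"
    using act_euler[OF f(1)] by (simp add: w_def act_simps algebra_simps)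
  then have "act w f = 0" unfolding m using vf by (simp add: algebra_simps)
  then have wD: "w \<in> D0 f" by (simp add: D0_iff)
  have wl: "act w l = (h + m * h) * l"
    using act_euler[OF l(1)] h by (simp add: w_def act_simps algebra_simps)
  \<comment> \<open>The new cofactor \<open>h + m * h\<close> is \<open>d + 1\<close> times
    \<open>m * h\<close>, so the lift removes exactly what was added.\<close>
  have "k * (h + m * h) = m * h"
  proof -
    have "h + m * h = (m * of_nat d) * h + m * h" unfolding m by simp
    also have "\<dots> = of_nat (d + 1) * (m * h)" by (simp add: algebra_simps)
    finally have "k * (h + m * h) = (k * of_nat (d + 1)) * (m * h)" by (simp only: mult.assoc)
    then show ?thesis unfolding k by simp
  qed
  then have "v = line_lift d w (h + m * h)" unfolding line_lift_def k_def[symmetric] w_def by simp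
  then show thesis using that wD wl by blast
qed

text \<open>\<open>s * l\<close> has degree \<open>k\<close>, so a nonzero \<open>s\<close> has
  degree \<open>k - 1\<close>, and the linear coefficients of \<open>EE\<close> restore degree
  \<open>k\<close>.\<close>

lemma htrip_line_lift:
  assumes "htrip k v" "hom 1 l" "l \<noteq> 0" "act v l = s * l"
  shows "htrip k (line_lift d v s)"
proof (cases "s = 0")
  case False
  have "hom k (s * l)" using hom_act_linear[OF assms(1,2)] assms(4) by simp
  then obtain i j where "hom i s" "hom j l" "i + j = k" using hom_factor False assms(3) by (metis mult_eq_0_iff)
  moreover from this have "j = 1" using hom_unique assms(2,3) by blast
  ultimately have "htrip (0 + i + 1) (smul (cst (1 / of_nat (d + 1)) * s) EE)"
    by (intro htrip_smul htrip_EE hom_mult hom_cst)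
  then show ?thesis unfolding line_lift_def using \<open>i + j = k\<close> \<open>j = 1\<close> by (intro htrip_diff assms) simp
qed (use assms in \<open>simp add: line_lift_def\<close>)

text \<open>A zero lift makes \<open>v\<close> a multiple of \<open>EE\<close>; but
  \<open>EE\<close> multiplies \<open>f\<close> by \<open>d\<close>, so only the zero multiple lies
  in \<open>D0 f\<close>.\<close>

lemma line_lift_nonzero:
  assumes "hom d f" "d > 0" "f \<noteq> 0" "v \<in> D0 f" "v \<noteq> 0"
  shows "line_lift d v s \<noteq> 0"
proof
  define k where "k = cst (1 / of_nat (d + 1))"
  assume "line_lift d v s = 0"
  then have v: "v = smul (k * s) EE" by (simp add: line_lift_def k_def)
  then have "k * s * (of_nat d * f) = 0" using assms(4) act_euler[OF assms(1)] by (simp add: D0_iff act_simps)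
  moreover have "of_nat d * f \<noteq> 0" using assms(2,3) by simp
  ultimately have "k * s = 0" by (metis mult_eq_0_iff)
  then show False using assms(5) unfolding v by (simp only: smul_0 simp_thms)
qed

text \<open>The lift is linear and reaches all of \<open>D0 (f * l)\<close> from the
  \<open>v\<close> in \<open>D0 f\<close> with \<open>l\<close> dividing \<open>act v l\<close>, so
  generators of that submodule lift to generators.\<close>

lemma generators_mult_linear:
  assumes f: "hom d f" "d > 0" "f \<noteq> 0" and l: "hom 1 l" "l \<noteq> 0" "\<not> l dvd f"
    and v: "v1 \<in> D0 f" "v2 \<in> D0 f" "v3 \<in> D0 f"
    and s: "act v1 l = s1 * l" "act v2 l = s2 * l" "act v3 l = s3 * l"
    and span: "\<And>v. v \<in> D0 f \<Longrightarrow> l dvd act v l \<Longrightarrow> \<exists>p q r. v = smul p v1 + smul q v2 + smul r v3"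
  shows "u \<in> D0 (f * l) \<longleftrightarrow>
    (\<exists>p q r. u = smul p (line_lift d v1 s1) + smul q (line_lift d v2 s2) + smul r (line_lift d v3 s3))"
proof
  assume "u \<in> D0 (f * l)"
  then obtain w t where w: "w \<in> D0 f" "act w l = t * l" "u = line_lift d w t"
    using D0_mult_linear[OF f(1,2) l] by blast
  then obtain p q r where pqr: "w = smul p v1 + smul q v2 + smul r v3" using span[OF w(1)] w(2) by (metis dvd_triv_right)
  have "t * l = (p * s1 + q * s2 + r * s3) * l"
    using w(2) s unfolding pqr by (simp add: act_simps algebra_simps)
  then have "t = p * s1 + q * s2 + r * s3" using l(2) by simp
  then have "u = smul p (line_lift d v1 s1) + smul q (line_lift d v2 s2) + smul r (line_lift d v3 s3)"
    unfolding w(3) pqr by (simp only: line_lift_comb)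
  then show "\<exists>p q r. u = smul p (line_lift d v1 s1) + smul q (line_lift d v2 s2) + smul r (line_lift d v3 s3)" by blast
next
  assume "\<exists>p q r. u = smul p (line_lift d v1 s1) + smul q (line_lift d v2 s2) + smul r (line_lift d v3 s3)"
  then show "u \<in> D0 (f * l)"
    using line_lift_in_D0[OF f(1) l(1) v(1) s(1)] line_lift_in_D0[OF f(1) l(1) v(2) s(2)]
      line_lift_in_D0[OF f(1) l(1) v(3) s(3)] by (auto simp: D0_iff act_simps(2,5))
qed

section \<open>Removing redundant generators\<close>

lemma smul_simps:
  "smul p (smul q v) = smul (p * q) v" "smul (p + q) v = smul p v + smul q v" "smul 1 v = v"
  "smul p (v + w) = smul p v + smul p w" "smul (p - q) v = smul p v - smul q v"
  "smul p (v - w) = smul p v - smul p w" "smul (- p) v = - smul p v" "smul p (- v) = - smul p v"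
  by (simp_all add: smul_def prod_eq_iff algebra_simps)

lemma smul_eq_0: "smul p v = 0 \<longleftrightarrow> p = 0 \<or> v = 0"
  by (cases v) (auto simp: smul_def zero_prod_def)

lemma drop_first_generator:
  assumes "t1 = smul a t2 + smul b t3"
  shows "(\<exists>p q r. u = smul p t1 + smul q t2 + smul r t3) \<longleftrightarrow> (\<exists>p q. u = smul p t2 + smul q t3)"
proof
  assume "\<exists>p q r. u = smul p t1 + smul q t2 + smul r t3"
  then obtain p q r where u: "u = smul p t1 + smul q t2 + smul r t3" by blast
  have "u = smul (q + p * a) t2 + smul (r + p * b) t3" unfolding u assms by (simp add: smul_simps)
  then show "\<exists>p q. u = smul p t2 + smul q t3" by blast
next
  assume "\<exists>p q. u = smul p t2 + smul q t3"
  then obtain p q where "u = smul 0 t1 + smul p t2 + smul q t3" by auto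
  then show "\<exists>p q r. u = smul p t1 + smul q t2 + smul r t3" by blast
qed

lemma swap_generators:
  "(\<exists>p q r. u = smul p t1 + smul q t2 + smul r t3) \<longleftrightarrow> (\<exists>p q r. u = smul p t2 + smul q t1 + smul r t3)"
  using add.commute[of "smul _ t1" "smul _ t2"] by metis

lemma free_or_plus_one_generated:
  assumes f: "hom d f" "d > 0" "squarefree f" and l: "hom 1 l" "l \<noteq> 0" "\<not> l dvd f"
    and sys: "hom_gen_sys f [r1, r2] [d1, d2]" and le: "d1 \<le> d2"
  shows "free_curve (f * l) \<or> plus_one_generated (f * l) (d + 1)"
proof (rule disjCI)
  assume "\<not> plus_one_generated (f * l) (d + 1)"
  have fnz: "f \<noteq> 0" using f(3) by auto
  have fl: "hom (d + 1) (f * l)" "d + 1 > 0" "f * l \<noteq> 0" using hom_mult[OF f(1) l(1)] fnz l by auto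
  note deg = free_exponents(1)[OF f sys] and indep = free_exponents(2)[OF f sys]
  have r: "htrip d1 r1" "htrip d2 r2" "r1 \<noteq> 0" "r2 \<noteq> 0"
    and D0f: "v \<in> D0 f \<longleftrightarrow> (\<exists>p q. v = smul p r1 + smul q r2)" for v
    using sys unfolding hom_gen_sys_2 by blast+
  have D0I: "smul p r1 + smul q r2 \<in> D0 f" for p q using D0f by blast
  have rD: "r1 \<in> D0 f" "r2 \<in> D0 f" using D0I[of 1 0] D0I[of 0 1] by (simp_all add: smul_simps)
  have two: "free_curve (f * l)"
    if g: "htrip k1 g1" "htrip k2 g2" "g1 \<noteq> 0" "g2 \<noteq> 0"
      "\<And>v. v \<in> D0 (f * l) \<longleftrightarrow> (\<exists>p q. v = smul p g1 + smul q g2)" for g1 g2 k1 k2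
  proof -
    have "hom_gen_sys (f * l) [g1, g2] [k1, k2]" unfolding hom_gen_sys_2 using g by blast
    then show ?thesis unfolding free_curve_def by (rule mingens_2[OF fl])
  qed
  define a1 a2 where a: "a1 = act r1 l" "a2 = act r2 l"
  have ha: "hom d1 a1" "hom d2 a2" unfolding a by (intro hom_act_linear r l)+
  show "free_curve (f * l)"
  proof (cases "l dvd a1 \<and> l dvd a2")
    \<comment> \<open>Both forms vanish on the line, so all of \<open>D0 f\<close> lifts;
      \<open>r1\<close> is listed twice to fit the lemma for three generators.\<close>
    case True
    then obtain s1 s2 where s: "act r1 l = s1 * l" "act r2 l = s2 * l"
      unfolding a by (metis dvd_def mult.commute)
    have "u \<in> D0 (f * l) \<longleftrightarrow>
        (\<exists>p q r. u = smul p (line_lift d r1 s1) + smul q (line_lift d r2 s2) + smul r (line_lift d r1 s1))" for u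
    proof (rule generators_mult_linear[OF f(1,2) fnz l rD rD(1) s s(1)])
      fix v assume "v \<in> D0 f"
      then obtain p q where "v = smul p r1 + smul q r2 + smul 0 r1" using D0f by auto
      then show "\<exists>p q r. v = smul p r1 + smul q r2 + smul r r1" by blast
    qed
    moreover have "line_lift d r1 s1 = smul 0 (line_lift d r2 s2) + smul 1 (line_lift d r1 s1)"
      by (simp add: smul_simps)
    ultimately have "u \<in> D0 (f * l) \<longleftrightarrow> (\<exists>p q. u = smul p (line_lift d r2 s2) + smul q (line_lift d r1 s1))" for u
      using drop_first_generator by blast
    then show ?thesis
      by (intro two[of d2 "line_lift d r2 s2" d1 "line_lift d r1 s1"] htrip_line_lift[OF _ l(1,2)] line_lift_nonzero[OF f(1,2) fnz] r rD s)
  next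
    case False
    then have nz: "\<not> l dvd a1 \<or> \<not> l dvd a2" by blast
    obtain b1 b2 e where b: "b1 \<noteq> 0 \<longrightarrow> e \<le> d1 \<and> hom (d1 - e) b1"
      "b2 \<noteq> 0 \<longrightarrow> e \<le> d2 \<and> hom (d2 - e) b2" "coprime b1 b2" "l dvd b2 * a1 - b1 * a2"
      "\<forall>u v. l dvd u * a1 + v * a2 \<longrightarrow> (\<exists>w u' v'. u = w * b2 + u' * l \<and> v = v' * l - w * b1)"
      by (rule syzygies_mod_linear[OF l(1,2) ha nz])
    define v1 v2 v3 where v: "v1 = smul l r1" "v2 = smul l r2" "v3 = smul b2 r1 - smul b1 r2"
    obtain s3 where s3: "b2 * a1 - b1 * a2 = s3 * l" using b(4) by (metis dvdE mult.commute)
    have s: "act v1 l = a1 * l" "act v2 l = a2 * l" "act v3 l = s3 * l"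
      using s3 by (simp_all add: v a act_simps)
    have vD: "v1 \<in> D0 f" "v2 \<in> D0 f" "v3 \<in> D0 f" using rD by (simp_all add: D0_iff v act_simps)
    define t1 t2 t3 where t: "t1 = line_lift d v1 a1" "t2 = line_lift d v2 a2" "t3 = line_lift d v3 s3"
    have gen: "u \<in> D0 (f * l) \<longleftrightarrow> (\<exists>p q r. u = smul p t1 + smul q t2 + smul r t3)" for u
      unfolding t
    proof (rule generators_mult_linear[OF f(1,2) fnz l vD s])
      fix v assume "v \<in> D0 f" "l dvd act v l"
      then obtain p q where pq: "v = smul p r1 + smul q r2" using D0f by blast
      then have "l dvd p * a1 + q * a2" using \<open>l dvd act v l\<close> by (simp add: act_simps a)
      then obtain w p' q' where "p = w * b2 + p' * l" "q = q' * l - w * b1" using b(5) by blast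
      then have "v = smul p' v1 + smul q' v2 + smul w v3" by (simp add: pq v smul_simps)
      then show "\<exists>p q r. v = smul p v1 + smul q v2 + smul r v3" by blast
    qed
    \<comment> \<open>The triples and their cofactors satisfy the same relation, so it lifts. It
      makes a generator redundant once \<open>b1\<close> or \<open>b2\<close> is a unit.\<close>
    have rel: "smul l t3 = smul b2 t1 - smul b1 t2"
    proof -
      have "smul b2 t1 + smul (- b1) t2 + smul (- l) t3 =
          line_lift d (smul b2 v1 + smul (- b1) v2 + smul (- l) v3) (b2 * a1 + (- b1) * a2 + (- l) * s3)"
        unfolding t by (rule line_lift_comb[symmetric])
      also have "b2 * a1 + (- b1) * a2 + (- l) * s3 = 0" using s3 by (simp add: algebra_simps)
      also have "smul b2 v1 + smul (- b1) v2 + smul (- l) v3 = 0"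
        by (simp add: v smul_simps mult.commute)
      finally have "smul b2 t1 + smul (- b1) t2 + smul (- l) t3 = 0" by (simp add: line_lift_def)
      then show ?thesis by (simp add: smul_simps)
    qed
    have "v3 \<noteq> 0"
    proof
      assume "v3 = 0"
      then have "smul b2 r1 + smul (- b1) r2 = 0" by (simp add: v smul_simps)
      then have "b2 = 0" "b1 = 0" using indep[of b2 "- b1"] by simp_all
      then show False using b(3) by simp
    qed
    moreover have "v1 \<noteq> 0" "v2 \<noteq> 0" using r l(2) by (simp_all add: v smul_eq_0)
    ultimately have tnz: "t1 \<noteq> 0" "t2 \<noteq> 0" "t3 \<noteq> 0"
      unfolding t using line_lift_nonzero[OF f(1,2) fnz] vD by blast+
    have "htrip (1 + d1) v1" "htrip (1 + d2) v2" unfolding v by (intro htrip_smul l r)+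
    \<comment> \<open>For \<open>b2 = 0\<close> nothing is known about \<open>e\<close> and
      \<open>d2\<close>, but the zero triple is homogeneous of every degree.\<close>
    moreover have "htrip (d1 + d2 - e) (smul b2 r1)"
    proof (cases "b2 = 0")
      case False
      then show ?thesis using htrip_smul[of "d2 - e" b2 d1 r1] b(2) r by (simp add: add.commute)
    qed simp
    moreover have "htrip (d1 + d2 - e) (smul b1 r2)"
    proof (cases "b1 = 0")
      case False
      then show ?thesis using htrip_smul[of "d1 - e" b1 d2 r2] b(1) r by (simp add: add.commute)
    qed simp
    ultimately have ht: "htrip (d1 + 1) t1" "htrip (d2 + 1) t2" "htrip (d1 + d2 - e) t3"
      unfolding t by (intro htrip_line_lift[OF _ l(1,2)] s, simp add: v htrip_diff)+
    \<comment> \<open>If \<open>b1\<close> or \<open>b2\<close> is zero, coprimality makes the other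
      a unit, so both are nonzero in the last case.\<close>
    consider "is_unit b1" | "is_unit b2" | "\<not> is_unit b1" "\<not> is_unit b2" by blast
    then show ?thesis
    proof cases
      case 1
      then obtain c where c: "c * b1 = 1" by (metis dvd_def mult.commute)
      have "smul c (smul b1 t2) = smul c (smul b2 t1 - smul l t3)" using rel by simp
      then have "t2 = smul (c * b2) t1 + smul (- (c * l)) t3" using c by (simp add: smul_simps)
      then have "v \<in> D0 (f * l) \<longleftrightarrow> (\<exists>p q. v = smul p t1 + smul q t3)" for v
        unfolding gen swap_generators[of v t1 t2] by (rule drop_first_generator)
      then show ?thesis using two ht tnz by blast
    next
      case 2
      then obtain c where c: "c * b2 = 1" by (metis dvd_def mult.commute)
      have "smul c (smul b2 t1) = smul c (smul b1 t2 + smul l t3)" using rel by simp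
      then have "t1 = smul (c * b1) t2 + smul (c * l) t3" using c by (simp add: smul_simps)
      then have "v \<in> D0 (f * l) \<longleftrightarrow> (\<exists>p q. v = smul p t2 + smul q t3)" for v
        unfolding gen by (rule drop_first_generator)
      then show ?thesis using two ht tnz by blast
    next
      case 3
      then have bnz: "b1 \<noteq> 0" "b2 \<noteq> 0" using b(3) by auto
      \<comment> \<open>Nonzero nonunit forms have positive degree; \<open>e < d1\<close> then
        places the third degree last.\<close>
      have "d1 - e \<noteq> 0" "d2 - e \<noteq> 0" using b(1,2) 3 bnz hom_0_unit by metis+
      then have "d1 + 1 \<le> d2 + 1 \<and> d2 + 1 \<le> d1 + d2 - e" using le by linarith
      then have sorted: "sorted [d1 + 1, d2 + 1, d1 + d2 - e]" by simp
      have sys3: "hom_gen_sys (f * l) [t1, t2, t3] [d1 + 1, d2 + 1, d1 + d2 - e]"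
        unfolding hom_gen_sys_3 using ht tnz gen by blast
      show ?thesis
      proof (rule ccontr)
        assume "\<not> free_curve (f * l)"
        then have "mingens (f * l) 3" using mingens_3[OF fl sys3] by (simp add: free_curve_def)
        moreover have "[d1 + 1, d2 + 1, d1 + d2 - e] ! 0 + [d1 + 1, d2 + 1, d1 + d2 - e] ! 1 = d + 1"
          using deg by simp
        ultimately have "plus_one_generated (f * l) (d + 1)"
          unfolding plus_one_generated_def using sys3 sorted
          by (intro conjI exI[of _ "[t1, t2, t3]"] exI[of _ "[d1 + 1, d2 + 1, d1 + d2 - e]"]) auto
        then show False using \<open>\<not> plus_one_generated (f * l) (d + 1)\<close> by blast
      qed
    qed
  qed
qed

theorem theorem1p2:
  fixes f l :: poly3 and d :: nat
  assumes "hom d f" and "d \<ge> 3" and "squarefree f"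
    and "hom 1 l" and "l \<noteq> 0" and "\<not> l dvd f"
    and "free_curve f"
  shows "free_curve (f * l) \<or> plus_one_generated (f * l) (d + 1)"
proof -
  obtain gs ds where sys: "hom_gen_sys f gs ds" "length gs = 2"
    using assms(7) unfolding free_curve_def mingens_def by blast
  moreover have "length ds = 2" using sys unfolding hom_gen_sys_def by simp
  ultimately obtain r1 r2 d1 d2 where "gs = [r1, r2]" "ds = [d1, d2]"
    by (auto simp: numeral_2_eq_2 length_Suc_conv)
  with sys have s: "hom_gen_sys f [r1, r2] [d1, d2]" by simp
  \<comment> \<open>Swapping the basis covers the case that \<open>d2\<close> is the smaller
    degree.\<close>
  then have s': "hom_gen_sys f [r2, r1] [d2, d1]"
    unfolding hom_gen_sys_2 by (metis add.commute)
  have "d > 0" using assms(2) by simp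
  then show ?thesis
    using free_or_plus_one_generated[OF assms(1) _ assms(3-6) s]
      free_or_plus_one_generated[OF assms(1) _ assms(3-6) s'] by linarith
qed

end
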